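(* Let $n\ge 1$ and $k\ge 1$ be natural numbers with $k$ even, and suppose that $n\equiv 0 \pmod k$ or $n\equiv k-1 \pmod k$. If there is a symmetric $((n^2+n+k)_{n+1})$ configuration that satisfies the transitivity of parallels (TOPs) property, then either 1. $\frac{n^2+n}{k}$ is even and $n+1$ is a perfect square, or 2. $\frac{n^2+n}{k}$ is odd and $n-(k-1)$ is a perfect square.
   Context: A symmetric $(v_r)$ configuration is a pair $(\mathcal P,\mathcal L)$ where $\mathcal P$ is a finite set of $v$ points, $v\ge 3$, and $\mathcal L$ is a set of $v$ lines, each line being a subset of $\mathcal P$, such that each line contains exactly $r$ points, each point lies on exactly $r$ lines, and any two distinct points lie together on at most one line (equivalently, any two distinct lines share at most one point). Configurations are assumed connected: $\mathcal P$ cannot be split into two nonempty parts such that every line lies inside one of the parts. A $((n^2+n+k)_{n+1})$ configuration is a symmetric $(v_r)$ configuration with $v=n^2+n+k$ and $r=n+1$; $k$ is called its deficiency. Two lines are parallel (non-intersecting) if they have no point in common. A configuration has the transitivity of parallels (TOPs) property if, for all pairwise distinct lines $l_1,l_2,l_3$, whenever $l_1$ is parallel to both $l_2$ and $l_3$, then $l_2$ is parallel to $l_3$. Perfect squares include $0$. *)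

theory Defs
  imports
    "HOL-Number_Theory.Cong"
    "HOL-Computational_Algebra.Nth_Powers"
begin

text \<open>A configuration is given by its set \<open>P\<close> of points and its set \<open>L\<close> of lines, a line being
  a set of points.\<close>

definition connected_configuration :: "'a set \<Rightarrow> 'a set set \<Rightarrow> bool" where
  "connected_configuration P L \<longleftrightarrow>
     \<not> (\<exists>A B. A \<noteq> {} \<and> B \<noteq> {} \<and> A \<inter> B = {} \<and> A \<union> B = P \<and> (\<forall>l\<in>L. l \<subseteq> A \<or> l \<subseteq> B))"

definition symmetric_configuration :: "nat \<Rightarrow> nat \<Rightarrow> 'a set \<Rightarrow> 'a set set \<Rightarrow> bool" where
  "symmetric_configuration v r P L \<longleftrightarrow>
     v \<ge> 3 \<and>
     finite P \<and> card P = v \<and>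
     finite L \<and> card L = v \<and>
     (\<forall>l\<in>L. l \<subseteq> P \<and> card l = r) \<and>
     (\<forall>p\<in>P. card {l \<in> L. p \<in> l} = r) \<and>
     (\<forall>p\<in>P. \<forall>q\<in>P. p \<noteq> q \<longrightarrow> card {l \<in> L. p \<in> l \<and> q \<in> l} \<le> 1) \<and>
     connected_configuration P L"

definition parallel :: "'a set \<Rightarrow> 'a set \<Rightarrow> bool" where
  "parallel l l' \<longleftrightarrow> l \<inter> l' = {}"

definition TOPs :: "'a set set \<Rightarrow> bool" where
  "TOPs L \<longleftrightarrow>
     (\<forall>l1\<in>L. \<forall>l2\<in>L. \<forall>l3\<in>L. l1 \<noteq> l2 \<and> l1 \<noteq> l3 \<and> l2 \<noteq> l3 \<longrightarrow>
        parallel l1 l2 \<and> parallel l1 l3 \<longrightarrow> parallel l2 l3)"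

end

theory Submission
  imports Defs "Jordan_Normal_Form.Determinant"
begin

text \<open>Under TOPs, being equal or parallel is an equivalence relation on the lines, and all its
  classes have size \<open>k\<close>, so there are \<open>m = (n\<^sup>2 + n) div k + 1\<close> of them. The Gram matrix
  \<open>A\<^sup>T A\<close> of the incidence matrix \<open>A\<close> therefore depends only on \<open>n\<close> and \<open>k\<close>, and
  Sylvester's determinant identity, applied twice, gives
  \<open>(det A)\<^sup>2 = (n + 1) ^ (m (k - 1)) * (n + 1 - k) ^ (m - 1) * (n + 1)\<^sup>2\<close>. As \<open>k\<close> is even,
  the parity of \<open>m - 1\<close> decides which of \<open>n + 1\<close> and \<open>n + 1 - k\<close> must be a square.\<close>

section \<open>Determinant identities over an integral domain\<close>

text \<open>Both sides equal \<open>a ^ m * det F\<close> for one block matrix \<open>F\<close>: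
  clearing its lower left block by a factor \<open>?R\<close> on the right leaves
  \<open>a I + X Y\<close>, and by a factor \<open>?S\<close> on the left leaves
  \<open>a I + Y X\<close>. The power \<open>a ^ m\<close> is \<open>det ?S\<close>; keeping it on
  the left avoids division by \<open>a\<close>.\<close>

lemma sylvester_det_identity:
  fixes a :: "'a::idom"
  assumes X: "X \<in> carrier_mat v m" and Y: "Y \<in> carrier_mat m v"
  shows "a ^ m * det (a \<cdot>\<^sub>m 1\<^sub>m v + X * Y) = a ^ v * det (a \<cdot>\<^sub>m 1\<^sub>m m + Y * X)"
proof -
  define F where "F = four_block_mat (a \<cdot>\<^sub>m 1\<^sub>m v) X (- Y) (1\<^sub>m m)"
  have F: "F \<in> carrier_mat (v + m) (v + m)"
    using X Y by (simp add: F_def)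
  let ?R = "four_block_mat (1\<^sub>m v) (0\<^sub>m v m) Y (1\<^sub>m m)"
  let ?S = "four_block_mat (1\<^sub>m v) (0\<^sub>m v m) Y (a \<cdot>\<^sub>m 1\<^sub>m m)"
  have R: "?R \<in> carrier_mat (v + m) (v + m)" and S: "?S \<in> carrier_mat (v + m) (v + m)"
    using Y by auto
  have dR: "det ?R = 1"
    using det_four_block_mat_upper_right_zero[of "1\<^sub>m v" v "0\<^sub>m v m" m Y "1\<^sub>m m"] Y by simp
  have dS: "det ?S = a ^ m"
    using det_four_block_mat_upper_right_zero[of "1\<^sub>m v" v "0\<^sub>m v m" m Y "a \<cdot>\<^sub>m 1\<^sub>m m"] Y by simp
  have "F * ?R = four_block_mat (a \<cdot>\<^sub>m 1\<^sub>m v + X * Y) X (0\<^sub>m m v) (1\<^sub>m m)"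
    unfolding F_def
    by (subst mult_four_block_mat[of _ v v _ m _ m _ _ v _ m]) (use X Y in auto)
  then have 1: "det F = det (a \<cdot>\<^sub>m 1\<^sub>m v + X * Y)"
    using det_mult[OF F R] dR
      det_four_block_mat_lower_left_zero[of "a \<cdot>\<^sub>m 1\<^sub>m v + X * Y" v X m "0\<^sub>m m v" "1\<^sub>m m"] X Y
    by simp
  have aY: "Y * (a \<cdot>\<^sub>m 1\<^sub>m v) = a \<cdot>\<^sub>m Y" "(a \<cdot>\<^sub>m 1\<^sub>m m) * Y = a \<cdot>\<^sub>m Y"
    using Y by (auto simp: mult_smult_distrib[of _ m v] mult_smult_assoc_mat[of _ m m])
  have aY0: "a \<cdot>\<^sub>m Y + - (a \<cdot>\<^sub>m Y) = 0\<^sub>m m v"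
    using Y by (intro eq_matI) auto
  have "?S * F = four_block_mat (a \<cdot>\<^sub>m 1\<^sub>m v) X (0\<^sub>m m v) (a \<cdot>\<^sub>m 1\<^sub>m m + Y * X)"
    unfolding F_def
    by (subst mult_four_block_mat[of _ v v _ m _ m _ _ v _ m])
      (use X Y aY aY0 in \<open>auto simp: comm_add_mat[of _ m m]\<close>)
  then have 2: "a ^ m * det F = a ^ v * det (a \<cdot>\<^sub>m 1\<^sub>m m + Y * X)"
    using det_mult[OF S F] dS
      det_four_block_mat_lower_left_zero[of "a \<cdot>\<^sub>m 1\<^sub>m v" v X m "0\<^sub>m m v" "a \<cdot>\<^sub>m 1\<^sub>m m + Y * X"] X Y
    by simp
  show ?thesis
    using 1 2 by simp
qed

text \<open>The constant matrix has rank at most one, a column of \<open>c\<close> times a row of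
  ones, so Sylvester's identity reduces the determinant to size 1.\<close>

lemma det_scalar_plus_constant:
  fixes b c :: "'a::idom"
  shows "b * det (b \<cdot>\<^sub>m 1\<^sub>m m + mat m m (\<lambda>_. c)) = b ^ m * (b + of_nat m * c)"
proof -
  let ?X = "mat m 1 (\<lambda>_. c)" and ?Y = "mat 1 m (\<lambda>_. 1)"
  have "?X * ?Y = mat m m (\<lambda>_. c)"
    by (rule eq_matI) (auto simp: scalar_prod_def)
  moreover have "det (b \<cdot>\<^sub>m 1\<^sub>m 1 + ?Y * ?X) = b + of_nat m * c"
    by (subst det_single) (auto simp: scalar_prod_def)
  ultimately show ?thesis
    using sylvester_det_identity[of ?X m 1 ?Y b] by simp
qed

text \<open>Off the diagonal the matrix records whether \<open>i\<close> and \<open>j\<close> lie in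
  different classes. It is \<open>a I + X Y\<close> with \<open>X\<close> the class indicator and
  \<open>Y\<close> its transposed complement, which trades size \<open>v\<close> for size
  \<open>m\<close>.\<close>

lemma det_partition_gram:
  fixes a :: "'a::idom"
  assumes c: "\<And>i. i < v \<Longrightarrow> c i < m"
    and fib: "\<And>j. j < m \<Longrightarrow> card {i. i < v \<and> c i = j} = k"
  defines "b \<equiv> a - of_nat k"
  shows "a ^ m * (b * det (mat v v (\<lambda>(i, j). if i = j then a else if c i = c j then 0 else 1)))
    = a ^ v * (b ^ m * (b + of_nat m * of_nat k))"
proof -
  let ?G = "mat v v (\<lambda>(i, j). if i = j then a else if c i = c j then 0 else 1)"
  let ?X = "mat v m (\<lambda>(i, j). if c i = j then 1 else 0) :: 'a mat"
  let ?Y = "mat m v (\<lambda>(j, i). if c i = j then 0 else 1) :: 'a mat"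
  have G: "?G = a \<cdot>\<^sub>m 1\<^sub>m v + ?X * ?Y"
  proof (rule eq_matI, goal_cases)
    case (1 i j)
    then have "i < v" "j < v" by auto
    then have "(?X * ?Y) $$ (i, j) = (\<Sum>l<m. (if c i = l then 1 else 0) * (if c j = l then 0 else 1))"
      by (simp add: scalar_prod_def atLeast0LessThan)
    also have "\<dots> = (\<Sum>l<m. if c i = l then if c j = l then 0 else 1 else 0)"
      by (intro sum.cong) auto
    also have "\<dots> = (if c j = c i then 0 else 1)"
      using c[OF \<open>i < v\<close>] by simp
    finally show ?case
      using \<open>i < v\<close> \<open>j < v\<close> by (simp del: index_mult_mat(1))
  qed auto
  \<comment> \<open>Entry \<open>(i, j)\<close> of \<open>?Y * ?X\<close> counts the members of
    class \<open>j\<close> outside class \<open>i\<close>: \<open>0\<close> on the diagonal and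
    \<open>k\<close> elsewhere. Filling the diagonal with \<open>k\<close> turns \<open>a\<close>
    into \<open>b = a - k\<close>.\<close>
  have YX: "a \<cdot>\<^sub>m 1\<^sub>m m + ?Y * ?X = b \<cdot>\<^sub>m 1\<^sub>m m + mat m m (\<lambda>_. of_nat k)"
  proof (rule eq_matI, goal_cases)
    case (1 i j)
    then have ij: "i < m" "j < m" by auto
    then have "(?Y * ?X) $$ (i, j) = (\<Sum>l<v. (if c l = i then 0 else 1) * (if c l = j then 1 else 0))"
      by (simp add: scalar_prod_def atLeast0LessThan)
    also have "\<dots> = (\<Sum>l<v. if c l = j then if i = j then 0 else 1 else 0)"
      by (intro sum.cong) auto
    also have "\<dots> = (\<Sum>l\<in>{l. l < v \<and> c l = j}. if i = j then 0 else 1)"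
      by (subst sum.inter_filter[symmetric]) auto
    also have "\<dots> = (if i = j then 0 else of_nat k)"
      using fib[OF ij(2)] by simp
    finally show ?case
      using ij by (simp add: b_def del: index_mult_mat(1))
  qed auto
  have "a ^ m * det ?G = a ^ v * det (b \<cdot>\<^sub>m 1\<^sub>m m + mat m m (\<lambda>_. of_nat k))"
    unfolding G YX[symmetric] by (rule sylvester_det_identity[of ?X v m ?Y a]) auto
  then show ?thesis
    using det_scalar_plus_constant[of b m "of_nat k"] by (simp add: mult.left_commute)
qed

section \<open>Parallel classes of lines\<close>

locale configuration =
  fixes P :: "'a set" and L :: "'a set set" and v r :: nat
  assumes config: "symmetric_configuration v r P L"
begin

lemma finite_points: "finite P" and card_points: "card P = v"
  and finite_lines: "finite L" and card_lines: "card L = v"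
  and line_subset: "l \<in> L \<Longrightarrow> l \<subseteq> P" and card_line: "l \<in> L \<Longrightarrow> card l = r"
  and card_pencil: "p \<in> P \<Longrightarrow> card {l \<in> L. p \<in> l} = r"
  and card_joining: "p \<in> P \<Longrightarrow> q \<in> P \<Longrightarrow> p \<noteq> q \<Longrightarrow> card {l \<in> L. p \<in> l \<and> q \<in> l} \<le> 1"
  using config by (auto simp: symmetric_configuration_def)

lemma finite_line: "l \<in> L \<Longrightarrow> finite l"
  using finite_points line_subset finite_subset by blast

text \<open>Two common points would be joined by both lines, against
  \<open>card_joining\<close>.\<close>

lemma common_point_unique:
  assumes "l \<in> L" "l' \<in> L" "l \<noteq> l'" "p \<in> l \<inter> l'" "q \<in> l \<inter> l'"
  shows "p = q"
proof (rule ccontr)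
  assume "p \<noteq> q"
  then have "card {l \<in> L. p \<in> l \<and> q \<in> l} \<le> 1"
    using assms line_subset by (intro card_joining) auto
  moreover have "card {l, l'} \<le> card {l \<in> L. p \<in> l \<and> q \<in> l}"
    using assms finite_lines by (intro card_mono) auto
  ultimately show False
    using assms by simp
qed

lemma card_inter_lines:
  assumes "l \<in> L" "l' \<in> L" "l \<noteq> l'" "\<not> parallel l l'"
  shows "card (l \<inter> l') = 1"
proof -
  obtain p where "p \<in> l \<inter> l'"
    using assms by (auto simp: parallel_def)
  then have "l \<inter> l' = {p}"
    using common_point_unique[OF assms(1-3)] by blast
  then show ?thesis by simp
qed

text \<open>The line \<open>l\<close> is added by hand, since a nonempty line is not disjoint from
  itself.\<close>

definition par_class :: "'a set \<Rightarrow> 'a set set" where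
  "par_class l = {l' \<in> L. l' = l \<or> parallel l l'}"

text \<open>The lines outside the class are those that meet \<open>l\<close> in exactly one point.
  Each of the \<open>r\<close> points of \<open>l\<close> carries \<open>r - 1\<close> of them, and
  none is counted twice.\<close>

lemma card_par_class:
  assumes l: "l \<in> L"
  shows "card (par_class l) + r * (r - 1) = v"
proof -
  let ?T = "\<lambda>p. {l' \<in> L. p \<in> l'} - {l}"
  have "card (\<Union>p\<in>l. ?T p) = (\<Sum>p\<in>l. card (?T p))"
    using common_point_unique[OF l] finite_lines finite_line[OF l]
    by (intro card_UN_disjoint) auto
  also have "\<dots> = (\<Sum>p\<in>l. r - 1)"
    using l line_subset card_pencil finite_lines by (intro sum.cong) (auto simp: card_Diff_singleton)
  also have "\<dots> = r * (r - 1)"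
    using card_line[OF l] by simp
  finally have "card (\<Union>p\<in>l. ?T p) = r * (r - 1)" .
  moreover have "L = par_class l \<union> (\<Union>p\<in>l. ?T p)" "par_class l \<inter> (\<Union>p\<in>l. ?T p) = {}"
    using l by (auto simp: par_class_def parallel_def)
  ultimately show ?thesis
    using card_Un_disjoint[of "par_class l" "\<Union>p\<in>l. ?T p"] finite_lines card_lines
    by (metis finite_Un)
qed

lemma par_class_self: "l \<in> L \<Longrightarrow> l \<in> par_class l"
  by (simp add: par_class_def)

lemma par_class_subset:
  assumes "TOPs L" "x \<in> L" "y \<in> L" "parallel x y"
  shows "par_class x \<subseteq> par_class y"
proof
  fix z assume "z \<in> par_class x"
  then consider "z = x" | "z = y" | "z \<in> L" "parallel x z" "z \<noteq> x" "z \<noteq> y"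
    by (auto simp: par_class_def)
  then show "z \<in> par_class y"
  proof cases
    case 3
    show ?thesis
    \<comment> \<open>TOPs, applied with \<open>x\<close> as the common parallel, needs three
      distinct lines. The case \<open>x = y\<close> must be split off because an empty set is
      parallel to itself.\<close>
    proof (cases "x = y")
      case False
      then have "parallel y z"
        using assms 3 unfolding TOPs_def by metis
      then show ?thesis
        using 3 by (simp add: par_class_def)
    qed (use \<open>z \<in> par_class x\<close> in simp)
  qed (use assms in \<open>auto simp: par_class_def parallel_def\<close>)
qed

lemma par_class_eq:
  assumes "TOPs L" "l \<in> L" "l' \<in> par_class l"
  shows "par_class l' = par_class l"
proof (cases "l' = l")
  case False
  then have "l' \<in> L" "parallel l l'" "parallel l' l"
    using assms(3) by (auto simp: par_class_def parallel_def)
  then show ?thesis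
    using assms(1,2) par_class_subset by (intro equalityI) simp_all
qed simp

lemma par_class_eq_iff:
  assumes "TOPs L" "l \<in> L" "l' \<in> L"
  shows "par_class l = par_class l' \<longleftrightarrow> l = l' \<or> parallel l l'"
proof
  assume "par_class l = par_class l'"
  then show "l = l' \<or> parallel l l'"
    using par_class_self[OF assms(3)] by (auto simp: par_class_def)
next
  assume "l = l' \<or> parallel l l'"
  then have "l' \<in> par_class l"
    using assms by (auto simp: par_class_def)
  then show "par_class l = par_class l'"
    using par_class_eq assms by metis
qed

section \<open>Determinant of the incidence matrix\<close>

text \<open>Here \<open>m\<close> is the number of parallel classes and \<open>D\<close> the
  determinant of the incidence matrix. The factor \<open>r - k\<close> stays on the left because it
  may vanish.\<close>

lemma tops_det_square:
  assumes tops: "TOPs L" and k: "v = r * (r - 1) + k"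
  obtains m and D :: int where "v = m * k"
    and "int r ^ m * ((int r - int k) * D\<^sup>2) =
      int r ^ v * ((int r - int k) ^ m * (int r - int k + int v))"
proof -
  let ?C = "par_class ` L"
  define m where "m = card ?C"
  have cls: "card (par_class l) = k" if "l \<in> L" for l
    using card_par_class[OF that] k by simp
  have U: "\<Union>?C = L"
    using par_class_self by (auto simp: par_class_def)
  have "k * card ?C = card (\<Union>?C)"
  proof (rule card_partition)
    show "A \<inter> B = {}" if "A \<in> ?C" "B \<in> ?C" "A \<noteq> B" for A B
      using that par_class_eq[OF tops] by blast
  qed (use finite_lines U cls in auto)
  then have v: "v = m * k"
    using U card_lines by (simp add: m_def mult.commute)
  obtain f where f: "bij_betw f {0..<v} L"
    using ex_bij_betw_nat_finite[OF finite_lines] card_lines by auto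
  obtain g where g: "bij_betw g {0..<v} P"
    using ex_bij_betw_nat_finite[OF finite_points] card_points by auto
  obtain h where h: "bij_betw h ?C {0..<m}"
    using ex_bij_betw_finite_nat[of ?C] finite_lines by (auto simp: m_def)
  \<comment> \<open>Colouring each line index by the number of its parallel class gives the
    partition needed by \<open>det_partition_gram\<close>.\<close>
  define c where "c i = h (par_class (f i))" for i
  have fL: "f i \<in> L" if "i < v" for i
    using f that by (auto simp: bij_betw_def)
  have f_eq: "f i = f j \<longleftrightarrow> i = j" if "i < v" "j < v" for i j
    using f that by (auto simp: bij_betw_def inj_on_def)
  have c: "c i < m" if "i < v" for i
    using h fL[OF that] by (auto simp: c_def bij_betw_def)
  have c_eq: "c i = c j \<longleftrightarrow> f i = f j \<or> parallel (f i) (f j)" if "i < v" "j < v" for i j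
  proof -
    have "c i = c j \<longleftrightarrow> par_class (f i) = par_class (f j)"
      using h fL that inj_on_eq_iff[of h ?C] unfolding c_def bij_betw_def by blast
    then show ?thesis
      using par_class_eq_iff[OF tops] fL that by simp
  qed
  have fib: "card {i. i < v \<and> c i = j} = k" if "j < m" for j
  proof -
    have "j \<in> h ` ?C"
      using h that by (simp add: bij_betw_def)
    then obtain l where l: "l \<in> L" "h (par_class l) = j"
      by auto
    moreover have "l \<in> f ` {0..<v}"
      using f l(1) by (simp add: bij_betw_def)
    ultimately obtain i0 where i0: "i0 < v" "f i0 = l" "c i0 = j"
      by (auto simp: c_def)
    \<comment> \<open>The numbering \<open>f\<close> carries the fibre of \<open>c\<close> over
      \<open>j\<close> bijectively onto a parallel class, whose size is known to be
      \<open>k\<close>.\<close>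
    have "f ` {i. i < v \<and> c i = j} = par_class l"
    proof (intro equalityI subsetI)
      fix x assume "x \<in> f ` {i. i < v \<and> c i = j}"
      then obtain i where "x = f i" "i < v" "c i0 = c i"
        using i0 by auto
      then show "x \<in> par_class l"
        using c_eq[of i0 i] fL i0 by (auto simp: par_class_def)
    next
      fix x assume x: "x \<in> par_class l"
      then have "x \<in> f ` {0..<v}"
        using f by (auto simp: par_class_def bij_betw_def)
      then obtain i where i: "i < v" "x = f i"
        by auto
      then have "c i0 = c i"
        using x c_eq[of i0 i] i0 by (auto simp: par_class_def)
      then show "x \<in> f ` {i. i < v \<and> c i = j}"
        using i i0 by auto
    qed
    moreover have "inj_on f {i. i < v \<and> c i = j}"
      using f by (auto simp: bij_betw_def intro: inj_on_subset)
    ultimately show ?thesis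
      using card_image cls[OF l(1)] by metis
  qed
  define A where "A = (mat v v (\<lambda>(p, i). if g p \<in> f i then 1 else 0) :: int mat)"
  have A: "A \<in> carrier_mat v v"
    by (simp add: A_def)
  \<comment> \<open>Entry \<open>(i, j)\<close> counts the points common to lines \<open>i\<close>
    and \<open>j\<close>: \<open>r\<close> if they coincide, \<open>0\<close> if they are distinct
    and parallel, \<open>1\<close> if they meet.\<close>
  have "transpose_mat A * A =
    mat v v (\<lambda>(i, j). if i = j then int r else if c i = c j then 0 else 1)" (is "_ = ?G")
  proof (rule eq_matI, goal_cases)
    case (1 i j)
    then have ij: "i < v" "j < v"
      by auto
    have "(transpose_mat A * A) $$ (i, j) = (\<Sum>p\<in>{0..<v}. (if g p \<in> f i then 1 else 0) * (if g p \<in> f j then 1 else 0))"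
      using ij by (simp add: A_def scalar_prod_def)
    also have "\<dots> = (\<Sum>p\<in>{0..<v}. if g p \<in> f i \<inter> f j then 1 else 0)"
      by (intro sum.cong) auto
    also have "\<dots> = (\<Sum>q\<in>P. if q \<in> f i \<inter> f j then 1 else 0)"
      by (rule sum.reindex_bij_betw[OF g])
    also have "\<dots> = int (card {q \<in> P. q \<in> f i \<inter> f j})"
      using finite_points by (simp add: sum.inter_filter[symmetric])
    also have "{q \<in> P. q \<in> f i \<inter> f j} = f i \<inter> f j"
      using line_subset fL ij by blast
    also have "int (card (f i \<inter> f j)) = (if i = j then int r else if c i = c j then 0 else 1)"
      using c_eq[OF ij] f_eq[OF ij] fL ij card_line card_inter_lines[of "f i" "f j"]
      by (auto simp: parallel_def)
    finally show ?case
      using ij by (simp del: index_mult_mat(1))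
  qed (auto simp: A_def)
  then have "det ?G = (det A)\<^sup>2"
    using det_mult[of "transpose_mat A" v A] det_transpose[OF A] A by (simp add: power2_eq_square)
  then have "int r ^ m * ((int r - int k) * (det A)\<^sup>2) =
      int r ^ v * ((int r - int k) ^ m * (int r - int k + int v))"
    using det_partition_gram[OF c fib, where a = "int r"] v by simp
  then show thesis
    using that v by blast
qed

end

section \<open>Squares from the parity of the exponents\<close>

lemma is_square_of_nat_int:
  assumes "is_square (int x)"
  shows "is_square x"
proof -
  obtain t where "int x = t\<^sup>2"
    using assms by (auto elim: is_nth_powerE)
  then have "int x = int ((nat \<bar>t\<bar>)\<^sup>2)"
    by simp
  then have "x = (nat \<bar>t\<bar>)\<^sup>2"
    by (simp only: of_nat_eq_iff)
  then show ?thesis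
    by simp
qed

theorem theorem5p3:
  fixes n k :: nat and P :: "'a set" and L :: "'a set set"
  assumes "n \<ge> 1" and "k \<ge> 1" and "even k"
    and "[n = 0] (mod k) \<or> [n = k - 1] (mod k)"
    and "symmetric_configuration (n^2 + n + k) (n + 1) P L"
    and "TOPs L"
  shows "(even ((n^2 + n) div k) \<and> is_square (n + 1)) \<or>
         (odd ((n^2 + n) div k) \<and> is_square (int n - (int k - 1)))"
proof -
  interpret configuration P L "n^2 + n + k" "n + 1"
    by unfold_locales (rule assms(5))
  define a b where "a = int (n + 1)" and "b = int (n + 1) - int k"
  have eq: "n^2 + n + k = (n + 1) * (n + 1 - 1) + k"
    by (simp add: power2_eq_square)
  obtain m D where v: "n^2 + n + k = m * k"
    and det: "a ^ m * (b * D\<^sup>2) = a ^ (n^2 + n + k) * (b ^ m * (b + int (n^2 + n + k)))"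
    using tops_det_square[OF assms(6) eq] unfolding a_def b_def by metis
  \<comment> \<open>One class less than the total: cancelling \<open>k\<close> in
    \<open>m * k\<close> shows that \<open>q\<close> is the quotient whose parity is asked
    for.\<close>
  obtain q where m: "m = Suc q"
    using v assms(2) by (cases m) auto
  have nk: "n^2 + n = q * k"
    using v m by simp
  then have q: "(n^2 + n) div k = q"
    using assms(2) by simp
  have goal_b: "int n - (int k - 1) = b"
    by (simp add: b_def)
  have a: "a \<noteq> 0"
    by (simp add: a_def)
  show ?thesis
  \<comment> \<open>For \<open>b = 0\<close> the determinant equation cannot be divided by
    \<open>b\<close>. Then \<open>k = n + 1\<close> gives \<open>q = n\<close>, which is odd as
    \<open>k\<close> is even, and \<open>b = 0\<close> itself is the required square.\<close>
  proof (cases "b = 0")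
    case True
    then have "k = n + 1"
      by (simp add: b_def)
    then have "q * k = n * k"
      using nk by (simp add: power2_eq_square)
    then have "q = n"
      using assms(2) by simp
    then have "odd q"
      using assms(3) \<open>k = n + 1\<close> by simp
    then show ?thesis
      using True q goal_b by simp
  next
    case b: False
    obtain k' where k': "k = Suc k'" "odd k'"
      using assms(2,3) by (cases k) auto
    \<comment> \<open>This is the common row sum of the Gram matrix.\<close>
    have b_plus: "b + int (n^2 + n + k) = a\<^sup>2"
      by (simp add: a_def b_def power2_eq_square algebra_simps)
    have "(a ^ m * b) * D\<^sup>2 = (a ^ m * b) * (a ^ (m * k') * b ^ q * a\<^sup>2)"
    proof -
      have "a ^ (n^2 + n + k) = a ^ m * a ^ (m * k')"
        unfolding v by (simp add: k' power_add)
      then show ?thesis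
        using det b_plus by (simp add: m ac_simps)
    qed
    then have D: "D\<^sup>2 = a ^ (m * k') * b ^ q * a\<^sup>2"
      using a b by simp
    show ?thesis
    proof (cases "even q")
      case True
      then obtain s where s: "q = 2 * s"
        by blast
      \<comment> \<open>As \<open>k'\<close> is odd, \<open>m * k'\<close> has the parity of
        \<open>m = q + 1\<close>, opposite to that of \<open>q\<close>. So exactly one of
        \<open>a\<close> and \<open>b\<close> occurs to an odd power: here \<open>a\<close>, and
        \<open>b\<close> when \<open>q\<close> is odd. The remaining square factor is nonzero and
        cancels.\<close>
      have "odd (m * k')"
        using True m k' by simp
      then obtain t where t: "m * k' = 2 * t + 1"
        by (rule oddE)
      have "D\<^sup>2 = a * (a ^ t * b ^ s * a)\<^sup>2"
        unfolding D s t by (simp add: power_mult_distrib power_mult[symmetric] mult.commute)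
      then have "is_square (a * (a ^ t * b ^ s * a)\<^sup>2)"
        by (metis is_nth_power_nth_power)
      then have "is_square a"
        by (subst (asm) is_nth_power_mult_cancel_right) (use a b in auto)
      then show ?thesis
        using True q is_square_of_nat_int[of "n + 1"] by (simp add: a_def)
    next
      case False
      then obtain s where s: "q = 2 * s + 1"
        by (rule oddE)
      have "even (m * k')"
        using False m by simp
      then obtain t where t: "m * k' = 2 * t"
        by blast
      have "D\<^sup>2 = b * (a ^ t * b ^ s * a)\<^sup>2"
        unfolding D s t by (simp add: power_mult_distrib power_mult[symmetric] mult.commute)
      then have "is_square (b * (a ^ t * b ^ s * a)\<^sup>2)"
        by (metis is_nth_power_nth_power)
      then have "is_square b"
        by (subst (asm) is_nth_power_mult_cancel_right) (use a b in auto)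
      then show ?thesis
        using False q goal_b by simp
    qed
  qed
qed

end
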